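(* Let $R\approx 0.5335$ be the unique root in $(0,1)$ of the equation $$2y-3(1-y)\log\frac{1}{1-y}=0 .$$ Then for every $f(x)=\sum_{k=0}^{\infty}x^k a_k\in \mathcal{SRB}(\mathbb{B})$ (with $a_k\in\mathbb{O}$) and every $x\in\mathbb{B}$ with $0<|x|=r\le R$, $$\sum_{k=0}^{\infty}|x|^k\left(\frac{1}{k+1}\sum_{n=0}^{k}|a_n|\right)\le \frac{1}{r}\log\frac{1}{1-r}.$$ The radius $R$ cannot be improved, i.e. for every $r\in(R,1)$ there exists $f\in\mathcal{SRB}(\mathbb{B})$ for which this inequality fails for $|x|=r$.
   Context: $\mathbb{O}$ is the real algebra of octonions, $\mathbb{O}=\mathbb{H}+l\mathbb{H}$ ($\mathbb{H}$ the quaternions) with $\overline{a+lb}=\overline a-lb$ and $(a+lb)(c+ld)=(ac-d\overline b)+l(\overline a d+cb)$, a non-commutative, non-associative, alternative division algebra. $|x|=\sqrt{x\overline x}$ is the Euclidean norm on $\mathbb{R}^8$; it is multiplicative. $\mathbb{B}=\{x\in\mathbb{O}:|x|<1\}$, $\mathbb{S}=\{I\in\mathbb{O}:I^2=-1\}$, and $\mathbb{D}$ is the open unit disk of $\mathbb{C}$. Slice regular functions on $\mathbb{B}$: a stem function on $\mathbb{D}$ is $F=F_1+iF_2:\mathbb{D}\to\mathbb{O}\otimes_{\mathbb{R}}\mathbb{C}$ with $\mathbb{O}$-valued components satisfying $F_1(\overline z)=F_1(z)$, $F_2(\overline z)=-F_2(z)$. It induces the slice function $f:\mathbb{B}\to\mathbb{O}$,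 $f(\alpha+I\beta)=F_1(\alpha+i\beta)+I F_2(\alpha+i\beta)$ for $I\in\mathbb{S}$ and real $\alpha,\beta$ with $\alpha+i\beta\in\mathbb{D}$. The function $f$ is slice regular if $F$ is $C^1$ and satisfies the Cauchy–Riemann equations $\partial_\alpha F_1=\partial_\beta F_2$, $\partial_\beta F_1=-\partial_\alpha F_2$ on $\mathbb{D}$. Every slice regular function on $\mathbb{B}$ has a convergent power series expansion $f(x)=\sum_{k=0}^\infty x^k a_k$ with $a_k\in\mathbb{O}$. $\mathcal{SRB}(\mathbb{B})$ is the class of slice regular functions $f$ on $\mathbb{B}$ with $|f(x)|\le 1$ for all $x\in\mathbb{B}$. *)

theory Defs
  imports "HOL-Analysis.Analysis"
begin

section \<open>Quaternions\<close>

codatatype quat = Quat (Q0: real) (Q1: real) (Q2: real) (Q3: real)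

lemma quat_eqI [intro?]: "Q0 x = Q0 y \<Longrightarrow> Q1 x = Q1 y \<Longrightarrow> Q2 x = Q2 y \<Longrightarrow> Q3 x = Q3 y \<Longrightarrow> x = y"
  by (rule quat.expand) simp

lemma quat_eq_iff: "x = y \<longleftrightarrow> Q0 x = Q0 y \<and> Q1 x = Q1 y \<and> Q2 x = Q2 y \<and> Q3 x = Q3 y"
  by (auto intro: quat.expand)

instantiation quat :: real_algebra_1
begin

primcorec zero_quat where
  "Q0 0 = 0" | "Q1 0 = 0" | "Q2 0 = 0" | "Q3 0 = 0"

primcorec one_quat where
  "Q0 1 = 1" | "Q1 1 = 0" | "Q2 1 = 0" | "Q3 1 = 0"

primcorec plus_quat where
  "Q0 (x + y) = Q0 x + Q0 y"
| "Q1 (x + y) = Q1 x + Q1 y"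
| "Q2 (x + y) = Q2 x + Q2 y"
| "Q3 (x + y) = Q3 x + Q3 y"

primcorec uminus_quat where
  "Q0 (- x) = - Q0 x"
| "Q1 (- x) = - Q1 x"
| "Q2 (- x) = - Q2 x"
| "Q3 (- x) = - Q3 x"

primcorec minus_quat where
  "Q0 (x - y) = Q0 x - Q0 y"
| "Q1 (x - y) = Q1 x - Q1 y"
| "Q2 (x - y) = Q2 x - Q2 y"
| "Q3 (x - y) = Q3 x - Q3 y"

primcorec scaleR_quat where
  "Q0 (scaleR r x) = r * Q0 x"
| "Q1 (scaleR r x) = r * Q1 x"
| "Q2 (scaleR r x) = r * Q2 x"
| "Q3 (scaleR r x) = r * Q3 x"

primcorec times_quat where
  "Q0 (x * y) = Q0 x * Q0 y - Q1 x * Q1 y - Q2 x * Q2 y - Q3 x * Q3 y"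
| "Q1 (x * y) = Q0 x * Q1 y + Q1 x * Q0 y + Q2 x * Q3 y - Q3 x * Q2 y"
| "Q2 (x * y) = Q0 x * Q2 y - Q1 x * Q3 y + Q2 x * Q0 y + Q3 x * Q1 y"
| "Q3 (x * y) = Q0 x * Q3 y + Q1 x * Q2 y - Q2 x * Q1 y + Q3 x * Q0 y"

instance
  by standard (auto simp: quat_eq_iff algebra_simps)

end

primcorec qcnj :: "quat \<Rightarrow> quat" where
  "Q0 (qcnj x) = Q0 x"
| "Q1 (qcnj x) = - Q1 x"
| "Q2 (qcnj x) = - Q2 x"
| "Q3 (qcnj x) = - Q3 x"

instantiation quat :: real_inner
begin

definition inner_quat :: "quat \<Rightarrow> quat \<Rightarrow> real" where
  "inner_quat x y = Q0 x * Q0 y + Q1 x * Q1 y + Q2 x * Q2 y + Q3 x * Q3 y"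
definition norm_quat :: "quat \<Rightarrow> real" where
  "norm_quat x = sqrt (inner x x)"
definition sgn_quat :: "quat \<Rightarrow> quat" where
  "sgn_quat x = x /\<^sub>R norm x"
definition dist_quat :: "quat \<Rightarrow> quat \<Rightarrow> real" where
  "dist_quat x y = norm (x - y)"
definition uniformity_quat :: "(quat \<times> quat) filter" where
  "uniformity_quat = (INF e\<in>{0<..}. principal {(x, y). dist x y < e})"
definition open_quat :: "quat set \<Rightarrow> bool" where
  "open_quat U \<longleftrightarrow> (\<forall>x\<in>U. \<forall>\<^sub>F (x', y) in uniformity. x' = x \<longrightarrow> y \<in> U)"

instance
proof
  fix x y z :: quat and r :: real
  show "inner x y = inner y x" by (simp add: inner_quat_def)
  show "inner (x + y) z = inner x z + inner y z" by (simp add: inner_quat_def algebra_simps)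
  show "inner (r *\<^sub>R x) y = r * inner x y" by (simp add: inner_quat_def algebra_simps)
  show "0 \<le> inner x x" by (simp add: inner_quat_def)
  show "inner x x = 0 \<longleftrightarrow> x = 0"
    by (simp add: inner_quat_def quat_eq_iff add_nonneg_eq_0_iff)
qed (rule norm_quat_def sgn_quat_def dist_quat_def uniformity_quat_def open_quat_def)+

end

instantiation quat :: euclidean_space
begin

definition "Basis = {Quat 1 0 0 0, Quat 0 1 0 0, Quat 0 0 1 0, Quat 0 0 0 1}"

instance
proof
  show "(Basis :: quat set) \<noteq> {}" "finite (Basis :: quat set)"
    by (simp_all add: Basis_quat_def)
next
  fix u v :: quat
  assume "u \<in> Basis" "v \<in> Basis"
  then show "inner u v = (if u = v then 1 else 0)"
    unfolding Basis_quat_def by (elim insertE emptyE) (simp_all add: inner_quat_def)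
next
  fix x :: quat
  show "(\<forall>u\<in>Basis. inner x u = 0) \<longleftrightarrow> x = 0"
    by (subst quat_eq_iff) (simp add: Basis_quat_def inner_quat_def)
qed

end

section \<open>Octonions\<close>

text \<open>\<open>Oct a b\<close> is the octonion \<open>a + l b\<close>.\<close>

codatatype oct = Oct (Ofst: quat) (Osnd: quat)

lemma oct_eqI [intro?]: "Ofst x = Ofst y \<Longrightarrow> Osnd x = Osnd y \<Longrightarrow> x = y"
  by (rule oct.expand) simp

lemma oct_eq_iff: "x = y \<longleftrightarrow> Ofst x = Ofst y \<and> Osnd x = Osnd y"
  by (auto intro: oct.expand)

instantiation oct :: real_vector
begin

primcorec zero_oct where
  "Ofst 0 = 0" | "Osnd 0 = 0"

primcorec plus_oct where
  "Ofst (x + y) = Ofst x + Ofst y"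
| "Osnd (x + y) = Osnd x + Osnd y"

primcorec uminus_oct where
  "Ofst (- x) = - Ofst x"
| "Osnd (- x) = - Osnd x"

primcorec minus_oct where
  "Ofst (x - y) = Ofst x - Ofst y"
| "Osnd (x - y) = Osnd x - Osnd y"

primcorec scaleR_oct where
  "Ofst (scaleR r x) = r *\<^sub>R Ofst x"
| "Osnd (scaleR r x) = r *\<^sub>R Osnd x"

instance
  by standard (auto simp: oct_eq_iff algebra_simps)

end

text \<open>Multiplication is not associative, so only the syntactic class \<open>power\<close> is available;
  \<open>x ^ Suc n\<close> is \<open>x * x ^ n\<close>, and the bracketing is immaterial since octonions are
  power-associative.\<close>

instantiation oct :: power
begin

primcorec one_oct where
  "Ofst 1 = 1" | "Osnd 1 = 0"

primcorec times_oct where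
  "Ofst (x * y) = Ofst x * Ofst y - Osnd y * qcnj (Osnd x)"
| "Osnd (x * y) = qcnj (Ofst x) * Osnd y + Ofst y * Osnd x"

instance ..

end

primcorec ocnj :: "oct \<Rightarrow> oct" where
  "Ofst (ocnj x) = qcnj (Ofst x)"
| "Osnd (ocnj x) = - Osnd x"

instantiation oct :: real_inner
begin

definition inner_oct :: "oct \<Rightarrow> oct \<Rightarrow> real" where
  "inner_oct x y = inner (Ofst x) (Ofst y) + inner (Osnd x) (Osnd y)"
definition norm_oct :: "oct \<Rightarrow> real" where
  "norm_oct x = sqrt (inner x x)"
definition sgn_oct :: "oct \<Rightarrow> oct" where
  "sgn_oct x = x /\<^sub>R norm x"
definition dist_oct :: "oct \<Rightarrow> oct \<Rightarrow> real" where
  "dist_oct x y = norm (x - y)"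
definition uniformity_oct :: "(oct \<times> oct) filter" where
  "uniformity_oct = (INF e\<in>{0<..}. principal {(x, y). dist x y < e})"
definition open_oct :: "oct set \<Rightarrow> bool" where
  "open_oct U \<longleftrightarrow> (\<forall>x\<in>U. \<forall>\<^sub>F (x', y) in uniformity. x' = x \<longrightarrow> y \<in> U)"

instance
proof
  fix x y z :: oct and r :: real
  show "inner x y = inner y x" by (simp add: inner_oct_def inner_commute)
  show "inner (x + y) z = inner x z + inner y z" by (simp add: inner_oct_def inner_add_left)
  show "inner (r *\<^sub>R x) y = r * inner x y" by (simp add: inner_oct_def algebra_simps)
  show "0 \<le> inner x x" by (simp add: inner_oct_def)
  show "inner x x = 0 \<longleftrightarrow> x = 0"
    by (simp add: inner_oct_def oct_eq_iff add_nonneg_eq_0_iff)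
qed (rule norm_oct_def sgn_oct_def dist_oct_def uniformity_oct_def open_oct_def)+

end

instantiation oct :: euclidean_space
begin

definition "Basis = (\<lambda>b. Oct b 0) ` Basis \<union> (\<lambda>b. Oct 0 b) ` Basis"

instance
proof
  show "(Basis :: oct set) \<noteq> {}" "finite (Basis :: oct set)"
    by (simp_all add: Basis_oct_def)
next
  fix u v :: oct
  assume "u \<in> Basis" "v \<in> Basis"
  then show "inner u v = (if u = v then 1 else 0)"
    by (auto simp: Basis_oct_def inner_oct_def inner_Basis split: if_splits)
next
  fix x :: oct
  show "(\<forall>u\<in>Basis. inner x u = 0) \<longleftrightarrow> x = 0"
    by (simp add: Basis_oct_def inner_oct_def ball_Un oct_eq_iff euclidean_all_zero_iff)
qed

end

lemma oct_mult_ocnj: "x * ocnj x = (norm x)\<^sup>2 *\<^sub>R 1"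
  by (simp add: power2_norm_eq_inner inner_oct_def inner_quat_def oct_eq_iff quat_eq_iff algebra_simps)

lemma oct_alternative: "x * (x * y) = (x * x) * y" "(y * x) * x = y * (x * x)" for x y :: oct
  by (simp_all add: oct_eq_iff quat_eq_iff algebra_simps)

lemma norm_oct_mult: "norm (x * y) = norm x * norm (y :: oct)"
proof -
  have "inner (x * y) (x * y) = inner x x * inner y y"
    by (simp add: inner_oct_def inner_quat_def algebra_simps)
  then show ?thesis
    by (simp add: norm_oct_def real_sqrt_mult)
qed

section \<open>Slice regular functions on the unit ball\<close>

definition imaginary_units :: "oct set" where
  "imaginary_units = {I. I\<^sup>2 = - 1}"

text \<open>A stem function \<open>F\<^sub>1 + i F\<^sub>2\<close> on the unit disc is represented by the pair of its
  octonion-valued components.\<close>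

definition stem_function :: "(complex \<Rightarrow> oct) \<Rightarrow> (complex \<Rightarrow> oct) \<Rightarrow> bool" where
  "stem_function F1 F2 \<longleftrightarrow>
     (\<forall>z\<in>ball 0 1. F1 (cnj z) = F1 z \<and> F2 (cnj z) = - F2 z)"

definition induces_slice_function ::
    "(complex \<Rightarrow> oct) \<Rightarrow> (complex \<Rightarrow> oct) \<Rightarrow> (oct \<Rightarrow> oct) \<Rightarrow> bool" where
  "induces_slice_function F1 F2 f \<longleftrightarrow>
     (\<forall>I\<in>imaginary_units. \<forall>\<alpha> \<beta>. Complex \<alpha> \<beta> \<in> ball 0 1 \<longrightarrow>
        f (\<alpha> *\<^sub>R 1 + \<beta> *\<^sub>R I) = F1 (Complex \<alpha> \<beta>) + I * F2 (Complex \<alpha> \<beta>))"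

definition has_partials_on_disc ::
    "(complex \<Rightarrow> oct) \<Rightarrow> (complex \<Rightarrow> oct) \<Rightarrow> (complex \<Rightarrow> oct) \<Rightarrow> bool" where
  "has_partials_on_disc F F\<^sub>\<alpha> F\<^sub>\<beta> \<longleftrightarrow>
     (\<forall>z\<in>ball 0 1.
        ((\<lambda>t. F (Complex t (Im z))) has_vector_derivative F\<^sub>\<alpha> z) (at (Re z)) \<and>
        ((\<lambda>t. F (Complex (Re z) t)) has_vector_derivative F\<^sub>\<beta> z) (at (Im z)))"

text \<open>\<open>C\<^sup>1\<close> is expressed as existence and continuity of the partial derivatives of the components.
  Values of \<open>f\<close> outside the unit ball are irrelevant.\<close>

definition slice_regular :: "(oct \<Rightarrow> oct) \<Rightarrow> bool" where
  "slice_regular f \<longleftrightarrow>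
     (\<exists>F1 F2 F1\<^sub>\<alpha> F1\<^sub>\<beta> F2\<^sub>\<alpha> F2\<^sub>\<beta>.
        stem_function F1 F2 \<and> induces_slice_function F1 F2 f \<and>
        has_partials_on_disc F1 F1\<^sub>\<alpha> F1\<^sub>\<beta> \<and> has_partials_on_disc F2 F2\<^sub>\<alpha> F2\<^sub>\<beta> \<and>
        continuous_on (ball 0 1) F1\<^sub>\<alpha> \<and> continuous_on (ball 0 1) F1\<^sub>\<beta> \<and>
        continuous_on (ball 0 1) F2\<^sub>\<alpha> \<and> continuous_on (ball 0 1) F2\<^sub>\<beta> \<and>
        (\<forall>z\<in>ball 0 1. F1\<^sub>\<alpha> z = F2\<^sub>\<beta> z \<and> F1\<^sub>\<beta> z = - F2\<^sub>\<alpha> z))"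

definition SRB :: "(oct \<Rightarrow> oct) set" where
  "SRB = {f. slice_regular f \<and> (\<forall>x\<in>ball 0 1. norm (f x) \<le> 1)}"

definition power_series_expansion :: "(oct \<Rightarrow> oct) \<Rightarrow> (nat \<Rightarrow> oct) \<Rightarrow> bool" where
  "power_series_expansion f a \<longleftrightarrow> (\<forall>x\<in>ball 0 1. (\<lambda>k. x ^ k * a k) sums f x)"

definition cesaro_majorant_term :: "(nat \<Rightarrow> oct) \<Rightarrow> real \<Rightarrow> nat \<Rightarrow> real" where
  "cesaro_majorant_term a r k = r ^ k * (1 / real (k + 1) * (\<Sum>n=0..k. norm (a n)))"

end

theory Submission
  imports Defs "HOL-Complex_Analysis.Complex_Analysis"
begin

text \<open>
  The inequality rests on the bound \<open>|a\<^sub>n| \<le> 1 - |a\<^sub>0|\<^sup>2\<close> for \<open>n \<ge> 1\<close>. On a single slice \<open>\<complex>\<^sub>I\<close> a function in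
  the class is merely a map from the disc to the closed unit ball of \<open>\<complex>\<^sup>4\<close>, for which this bound
  fails in general; but \<open>I\<close> can be chosen with \<open>a\<^sub>n \<in> \<complex>\<^sub>I a\<^sub>0\<close>, and projecting onto that complex line
  gives a scalar function bounded by 1 whose coefficients \<open>0\<close> and \<open>n\<close> have moduli \<open>|a\<^sub>0|\<close>, \<open>|a\<^sub>n|\<close>.

  With \<open>A = |a\<^sub>0|\<close> and \<open>L = ln (1 / (1 - r)) / r\<close> the sum is then at most
  \<open>A L + (1 - A\<^sup>2) (1 / (1 - r) - L)\<close>, which is at most \<open>L\<close> for every \<open>A \<le> 1\<close> as soon as
  \<open>2 / (1 - r) \<le> 3 L\<close>, i.e. \<open>r \<le> R\<close>. Beyond \<open>R\<close> the Moebius functions \<open>(c - x) (1 - c x)\<^sup>-\<^sup>1\<close>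
  violate the inequality for real \<open>c < 1\<close> close to \<open>1\<close>.
\<close>

section \<open>Complex slices of the octonions\<close>

text \<open>Alternativity gives \<open>I * (I * y) = - y\<close>. The norm is multiplicative, so
  left multiplication by \<open>I\<close> is an isometry, and an isometry with square -1 is
  skew-adjoint. Hence it acts like the scalar i on a Hermitian space.\<close>

lemma imaginary_unit_mult:
  assumes "I \<in> imaginary_units"
  shows "I * (I * y) = - y" "norm I = 1" "inner (I * x) y = - inner x (I * y)"
proof -
  have II: "I * I = - 1"
    using assms by (simp add: imaginary_units_def numeral_2_eq_2 oct_eq_iff quat_eq_iff)
  show *: "I * (I * y) = - y" for y
    unfolding oct_alternative II by (simp add: oct_eq_iff quat_eq_iff)
  have "norm I * norm I = norm (- 1 :: oct)"
    by (simp only: II flip: norm_oct_mult)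
  also have "\<dots> = 1"
    by (simp add: norm_oct_def inner_oct_def inner_quat_def)
  finally have "(norm I)\<^sup>2 = 1"
    by (simp add: power2_eq_square)
  then show 1: "norm I = 1"
    using norm_ge_zero[of I] by (simp add: power2_eq_1_iff)
  have add: "I * (x + y) = I * x + I * y" for x y
    by (simp add: oct_eq_iff quat_eq_iff algebra_simps)
  \<comment> \<open>Polarization turns preservation of the norm into preservation of the inner
    product.\<close>
  have isom: "inner (I * x) (I * y) = inner x y" for x y
    using 1 by (simp add: dot_norm norm_oct_mult flip: add)
  show "inner (I * x) y = - inner x (I * y)"
    using isom[of x "I * y"] by (simp add: *)
qed

definition slice_embed :: "oct \<Rightarrow> complex \<Rightarrow> oct" where
  "slice_embed I z = Re z *\<^sub>R 1 + Im z *\<^sub>R I"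

lemma slice_embed_mult:
  "slice_embed I z * x = Re z *\<^sub>R x + Im z *\<^sub>R (I * x)"
  by (simp add: slice_embed_def oct_eq_iff quat_eq_iff algebra_simps)

lemma slice_embed_power:
  assumes "I \<in> imaginary_units"
  shows "slice_embed I z ^ k = slice_embed I (z ^ k)"
proof (induction k)
  case (Suc k)
  have "slice_embed I z ^ Suc k = slice_embed I z * slice_embed I (z ^ k)"
    by (simp add: Suc)
  also have "\<dots> = slice_embed I (z ^ Suc k)"
  proof -
    have "I * slice_embed I w = Re w *\<^sub>R I - Im w *\<^sub>R 1" for w
    proof -
      have "I * slice_embed I w = Re w *\<^sub>R I + Im w *\<^sub>R (I * (I * 1))"
        by (simp add: slice_embed_def oct_eq_iff quat_eq_iff algebra_simps)
      then show ?thesis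
        by (simp add: imaginary_unit_mult(1)[OF assms])
    qed
    then show ?thesis
      by (simp add: slice_embed_mult) (simp add: slice_embed_def algebra_simps)
  qed
  finally show ?case .
qed (simp add: slice_embed_def)

lemma norm_slice_embed:
  assumes "I \<in> imaginary_units"
  shows "norm (slice_embed I z) = norm z"
proof -
  have "inner I 1 = 0"
  proof -
    have "I * 1 = I"
      by (simp add: oct_eq_iff quat_eq_iff)
    then show ?thesis
      using imaginary_unit_mult(3)[OF assms, of 1 1] by (simp add: inner_commute)
  qed
  moreover have "inner I I = 1" "inner (1::oct) 1 = 1"
    using imaginary_unit_mult(2)[OF assms] by (simp_all add: norm_eq_1 inner_oct_def inner_quat_def)
  ultimately have "inner (slice_embed I z) (slice_embed I z) = (Re z)\<^sup>2 + (Im z)\<^sup>2"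
    by (simp add: slice_embed_def inner_add_left inner_add_right inner_commute[of 1 I] power2_eq_square)
  then show ?thesis
    by (simp add: norm_eq_sqrt_inner[of "slice_embed I z"] cmod_def)
qed

lemma bounded_linear_slice_embed: "bounded_linear (slice_embed I)"
  unfolding slice_embed_def
  by (intro bounded_linear_add bounded_linear_scaleR_left[THEN bounded_linear_compose]
      bounded_linear_Re bounded_linear_Im)

text \<open>The imaginary part \<open>v\<close> satisfies
  \<open>v * v = - (norm v)\<^sup>2 *\<^sub>R 1\<close>, so normalizing it gives an imaginary unit.
  A real \<open>x\<close> lies in every slice, and a fixed unit serves.\<close>

lemma oct_in_slice:
  obtains I z where "I \<in> imaginary_units" "x = slice_embed I z"
proof -
  define v where "v = x - Q0 (Ofst x) *\<^sub>R 1"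
  have v: "ocnj v = - v"
    by (simp add: v_def oct_eq_iff quat_eq_iff)
  have vv: "v * v = - (norm v)\<^sup>2 *\<^sub>R 1"
    using oct_mult_ocnj[of v] unfolding v by (simp add: oct_eq_iff quat_eq_iff)
  show thesis
  proof (cases "v = 0")
    case True
    have "Oct (Quat 0 1 0 0) 0 \<in> imaginary_units"
      by (simp add: imaginary_units_def numeral_2_eq_2 oct_eq_iff quat_eq_iff)
    then show thesis
      by (rule that[of _ "of_real (Q0 (Ofst x))"]) (use True in \<open>simp add: v_def slice_embed_def\<close>)
  next
    case False
    define I where "I = v /\<^sub>R norm v"
    have "I\<^sup>2 = (inverse (norm v))\<^sup>2 *\<^sub>R (v * v)"
      by (simp add: I_def numeral_2_eq_2 oct_eq_iff quat_eq_iff algebra_simps)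
    then have "I \<in> imaginary_units"
      using False by (simp add: imaginary_units_def vv power_inverse)
    then show thesis
      by (rule that[of _ "Complex (Q0 (Ofst x)) (norm v)"])
        (use False in \<open>simp add: slice_embed_def I_def v_def\<close>)
  qed
qed

text \<open>The coordinate of the \<open>\<complex>\<^sub>I\<close>-linear orthogonal projection onto the complex line through the
  unit vector \<open>u\<close>.\<close>

definition slice_coord :: "oct \<Rightarrow> oct \<Rightarrow> oct \<Rightarrow> complex" where
  "slice_coord I u y = Complex (inner y u) (inner y (I * u))"

lemma bounded_linear_slice_coord: "bounded_linear (slice_coord I u)"
proof -
  have "slice_coord I u = (\<lambda>y. of_real (inner y u) + \<i> * of_real (inner y (I * u)))"
    by (auto simp: slice_coord_def complex_eq_iff)
  then show ?thesis
    by (auto intro!: bounded_linear_intros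
        bounded_linear_compose[OF bounded_linear_of_real])
qed

text \<open>Skew-adjointness of left multiplication by \<open>I\<close> makes the real-linear
  coordinate complex linear.\<close>

lemma slice_coord_slice_embed_mult:
  assumes "I \<in> imaginary_units"
  shows "slice_coord I u (slice_embed I z * y) = z * slice_coord I u y"
  by (simp add: slice_coord_def slice_embed_mult complex_eq_iff inner_add_left
      imaginary_unit_mult[OF assms])

text \<open>Bessel's inequality for the orthonormal pair \<open>u\<close>,
  \<open>I * u\<close>.\<close>

lemma norm_slice_coord_le:
  assumes "I \<in> imaginary_units" "norm u = 1"
  shows "norm (slice_coord I u y) \<le> norm y"
proof -
  define a b where "a = inner y u" and "b = inner y (I * u)"
  have orth: "inner u (I * u) = 0"
    using imaginary_unit_mult(3)[OF assms(1), of u u] by (simp add: inner_commute)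
  have "inner u u = 1" "inner (I * u) (I * u) = 1"
    using assms(2) imaginary_unit_mult(2)[OF assms(1)] by (simp_all only: norm_oct_mult norm_eq_1[symmetric] mult_1)
  then have "inner (y - a *\<^sub>R u - b *\<^sub>R (I * u)) (y - a *\<^sub>R u - b *\<^sub>R (I * u)) = inner y y - a\<^sup>2 - b\<^sup>2"
    using orth inner_commute[of u y] inner_commute[of "I * u" y] inner_commute[of "I * u" u]
    by (simp add: inner_diff_left inner_diff_right a_def b_def power2_eq_square algebra_simps)
  then have "a\<^sup>2 + b\<^sup>2 \<le> inner y y"
    using inner_ge_zero[of "y - a *\<^sub>R u - b *\<^sub>R (I * u)"] by linarith
  then show ?thesis
    by (simp add: slice_coord_def a_def b_def cmod_def norm_eq_sqrt_inner)
qed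

lemma slice_coord_self:
  assumes "I \<in> imaginary_units" "norm u = 1"
  shows "slice_coord I u u = 1"
  using imaginary_unit_mult(3)[OF assms(1), of u u] assms(2)
  by (simp add: slice_coord_def complex_eq_iff inner_commute norm_eq_1)

section \<open>Coefficients of bounded power series\<close>

text \<open>Convergence on the whole disc identifies \<open>c n\<close> with the Taylor coefficient
  of \<open>h\<close> at 0, which Cauchy's formula for derivatives expresses as an integral.\<close>

lemma circlepath_power_series_coeff:
  fixes c :: "nat \<Rightarrow> complex"
  assumes sums: "\<And>z. norm z < 1 \<Longrightarrow> (\<lambda>k. c k * z ^ k) sums h z"
    and s: "0 < s" "s < 1"
  shows "((\<lambda>z. h z / z ^ Suc n) has_contour_integral (2 * pi * \<i> * c n)) (circlepath 0 s)"
proof -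
  have holo: "h holomorphic_on ball 0 1"
    by (rule power_series_holomorphic[where a = c]) (use sums in auto)
  have "ereal 1 \<le> fps_conv_radius (Abs_fps c)"
    unfolding fps_conv_radius_def
    by (rule conv_radius_geI_ex') (use sums in \<open>auto simp: sums_iff\<close>)
  then have "h has_fps_expansion Abs_fps c"
    unfolding has_fps_expansion_def
    using sums by (auto simp: eval_fps_def sums_iff eventually_nhds_metric less_le_trans[of 0 "ereal 1"]
        intro!: exI[of _ 1])
  then have "c n = (deriv ^^ n) h 0 / fact n"
    by (metis fps_nth_Abs_fps fps_nth_fps_expansion)
  moreover have "((\<lambda>z. h z / (z - 0) ^ Suc n) has_contour_integral (2 * pi * \<i>) / fact n * (deriv ^^ n) h 0) (circlepath 0 s)"
    by (rule Cauchy_has_contour_integral_higher_derivative_circlepath)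
      (use s in \<open>auto intro!: holomorphic_on_imp_continuous_on holomorphic_on_subset[OF holo]\<close>)
  ultimately show ?thesis
    by simp
qed

text \<open>Expanding the square leaves \<open>1 + (norm b)\<^sup>2\<close> and twice the real part
  of an oscillating term, which integrates to 0 over \<open>n > 0\<close> full periods;
  \<open>V\<close> is an explicit primitive of that real part.\<close>

lemma has_integral_norm_square_circle:
  assumes "n > 0"
  shows "((\<lambda>t. (norm (1 + b * exp (2 * of_real pi * \<i> * of_real t) ^ n))\<^sup>2) has_integral (1 + (norm b)\<^sup>2)) {0..1}"
proof -
  define w where "w = (\<lambda>z. b * exp (2 * of_real pi * \<i> * z * of_nat n))"
  define V where "V = (\<lambda>t::real. Re (w (of_real t) / (2 * of_real pi * \<i> * of_nat n)))"
  define G where "G = (\<lambda>t::real. (1 + (norm b)\<^sup>2) * t + 2 * V t)"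
  have deriv: "(G has_vector_derivative (norm (1 + w (of_real t)))\<^sup>2) (at t within {0..1})" for t :: real
  proof -
    have "((\<lambda>t. w (of_real t) / (2 * of_real pi * \<i> * of_nat n)) has_vector_derivative w (of_real t)) (at t within {0..1})"
      unfolding w_def
      by (rule has_vector_derivative_real_field) (use assms in \<open>auto intro!: derivative_eq_intros\<close>)
    then have "(V has_vector_derivative Re (w (of_real t))) (at t within {0..1})"
      unfolding V_def by (rule bounded_linear.has_vector_derivative[OF bounded_linear_Re])
    then have "(G has_vector_derivative (1 + (norm b)\<^sup>2) + 2 * Re (w (of_real t))) (at t within {0..1})"
      unfolding G_def by (auto intro!: derivative_eq_intros simp flip: has_real_derivative_iff_has_vector_derivative)
    moreover have "norm (w (of_real t)) = norm b"
      by (simp add: w_def norm_mult)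
    then have "(norm (1 + w (of_real t)))\<^sup>2 = (1 + (norm b)\<^sup>2) + 2 * Re (w (of_real t))"
      unfolding cmod_power2[of "1 + w (of_real t)"]
      by (simp flip: cmod_power2[of b]
            add: cmod_power2[of "w (of_real t)", unfolded \<open>norm (w (of_real t)) = norm b\<close>])
        (simp add: power2_eq_square algebra_simps)
    ultimately show ?thesis
      by simp
  qed
  have "w 1 = w 0"
    using exp_integer_2pi[of "of_nat n"] by (simp add: w_def mult_ac)
  then have "G 1 - G 0 = 1 + (norm b)\<^sup>2"
    by (simp add: G_def V_def)
  moreover have "((\<lambda>t. (norm (1 + w (of_real t)))\<^sup>2) has_integral (G 1 - G 0)) {0..1}"
    by (rule fundamental_theorem_of_calculus) (use deriv in auto)
  ultimately show ?thesis
    by (simp add: w_def mult_ac flip: exp_of_nat_mult)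
qed

text \<open>Multiplying by \<open>(1 + b z\<^sup>n)\<^sup>2\<close> turns the \<open>n\<close>-th coefficient into \<open>c\<^sub>n + 2 b c\<^sub>0\<close>, while the mean
  of \<open>|1 + b z\<^sup>n|\<^sup>2\<close> over the circle is only \<open>1 + |b|\<^sup>2\<close>; take \<open>|b| = |c\<^sub>0|\<close> with aligned argument.\<close>

lemma bounded_power_series_coeff_le:
  fixes c :: "nat \<Rightarrow> complex"
  assumes sums: "\<And>z. norm z < 1 \<Longrightarrow> (\<lambda>k. c k * z ^ k) sums h z"
    and le: "\<And>z. norm z < 1 \<Longrightarrow> norm (h z) \<le> 1"
    and n: "n > 0"
  shows "norm (c n) \<le> 1 - (norm (c 0))\<^sup>2"
proof -
  have holo: "h holomorphic_on ball 0 1"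
    by (rule power_series_holomorphic[where a = c]) (use sums in auto)
  have *: "s ^ n * norm (c n + 2 * b * c 0) \<le> 1 + (norm b)\<^sup>2 * (s ^ n)\<^sup>2" if s: "0 < s" "s < 1" for b s
  proof -
    \<comment> \<open>The Cauchy integrand for the coefficient \<open>n\<close> of
      \<open>h z * (1 + b * z ^ n)\<^sup>2\<close>. Expanding the square yields \<open>c n\<close>,
      then \<open>2 * b * c 0\<close>, and in \<open>third\<close> a holomorphic term with integral
      0.\<close>
    define q where "q = (\<lambda>z. h z / z ^ Suc n * (1 + b * z ^ n)\<^sup>2)"
    have third: "((\<lambda>z. b\<^sup>2 * (h z * z ^ (n - 1))) has_contour_integral b\<^sup>2 * 0) (circlepath 0 s)"
      by (intro has_contour_integral_lmul Cauchy_theorem_disc_simple[of _ 0 1])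
        (use s in \<open>auto intro!: holomorphic_intros holo\<close>)
    have "((\<lambda>z. h z / z ^ Suc n + 2 * b * (h z / z ^ Suc 0) + b\<^sup>2 * (h z * z ^ (n - 1)))
        has_contour_integral (2 * pi * \<i> * c n + 2 * b * (2 * pi * \<i> * c 0) + b\<^sup>2 * 0)) (circlepath 0 s)"
      by (intro has_contour_integral_add third has_contour_integral_lmul[of "\<lambda>z. h z / z ^ Suc 0"]
          circlepath_power_series_coeff sums s)
    moreover have "h z / z ^ Suc n + 2 * b * (h z / z ^ Suc 0) + b\<^sup>2 * (h z * z ^ (n - 1)) = q z"
      if "z \<noteq> 0" for z
      using that n by (cases n) (auto simp: q_def field_simps power2_eq_square)
    ultimately have "(q has_contour_integral 2 * pi * \<i> * (c n + 2 * b * c 0)) (circlepath 0 s)"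
      using s by (subst has_contour_integral_cong[where f' =
            "\<lambda>z. h z / z ^ Suc n + 2 * b * (h z / z ^ Suc 0) + b\<^sup>2 * (h z * z ^ (n - 1))"])
        (auto simp: algebra_simps)
    then have int: "((\<lambda>t. q (circlepath 0 s t) * (2 * pi * \<i> * s * exp (2 * of_real pi * \<i> * t)))
        has_integral 2 * pi * \<i> * (c n + 2 * b * c 0)) {0..1}"
      by (simp add: has_contour_integral vector_derivative_circlepath)
    \<comment> \<open>The path has speed \<open>2 * pi * s\<close> and \<open>z ^ Suc n\<close> has
      modulus \<open>s ^ Suc n\<close>, so \<open>norm (h z) \<le> 1\<close> bounds the integrand by
      this function.\<close>
    have sq: "((\<lambda>t. 2 * pi / s ^ n * (norm (1 + (b * s ^ n) * exp (2 * of_real pi * \<i> * of_real t) ^ n))\<^sup>2)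
        has_integral 2 * pi / s ^ n * (1 + (norm (b * s ^ n))\<^sup>2)) {0..1}"
      by (intro has_integral_mult_right has_integral_norm_square_circle n)
    have "norm (2 * pi * \<i> * (c n + 2 * b * c 0)) \<le> 2 * pi / s ^ n * (1 + (norm (b * s ^ n))\<^sup>2)"
    proof (rule has_integral_norm_bound_integral_component[OF int sq, where k = 1,
          simplified inner_real_def mult_1_right])
      fix t :: real
      define e where "e = exp (2 * of_real pi * \<i> * of_real t)"
      have e: "norm e = 1" and z: "circlepath 0 s t = s * e"
        by (simp_all add: e_def circlepath mult_ac)
      have "norm (h (s * e)) \<le> 1"
        using s by (intro le) (simp add: norm_mult e)
      then have "norm (h (s * e)) * (2 * pi / s ^ n * (norm (1 + b * s ^ n * e ^ n))\<^sup>2)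
          \<le> 1 * (2 * pi / s ^ n * (norm (1 + b * s ^ n * e ^ n))\<^sup>2)"
        using s by (intro mult_right_mono) auto
      then show "norm (q (circlepath 0 s t) * (2 * pi * \<i> * s * e))
          \<le> 2 * pi / s ^ n * (norm (1 + b * s ^ n * e ^ n))\<^sup>2"
        using s by (simp add: z q_def norm_mult norm_divide norm_power e power_mult_distrib field_simps)
    qed
    moreover have "norm (2 * pi * \<i> * (c n + 2 * b * c 0)) = 2 * pi * norm (c n + 2 * b * c 0)"
      by (simp add: norm_mult)
    ultimately have "2 * pi * norm (c n + 2 * b * c 0) \<le> 2 * pi * ((1 + (norm b)\<^sup>2 * (s ^ n)\<^sup>2) / s ^ n)"
      using s by (simp add: norm_mult norm_power power_mult_distrib)
    then have "norm (c n + 2 * b * c 0) \<le> (1 + (norm b)\<^sup>2 * (s ^ n)\<^sup>2) / s ^ n"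
      by (rule mult_left_le_imp_le) simp
    then show ?thesis
      using s by (simp add: pos_le_divide_eq mult.commute)
  qed
  define b where "b = norm (c 0) * cis (Arg (c n) - Arg (c 0))"
  have "c n + 2 * b * c 0 = (norm (c n) + 2 * (norm (c 0))\<^sup>2) * cis (Arg (c n))"
  proof -
    have "b * c 0 = norm (c 0) * cis (Arg (c n) - Arg (c 0)) * (norm (c 0) * cis (Arg (c 0)))"
      by (metis b_def rcis_cmod_Arg rcis_def)
    also have "\<dots> = (norm (c 0))\<^sup>2 * (cis (Arg (c n) - Arg (c 0)) * cis (Arg (c 0)))"
      by (simp add: power2_eq_square)
    finally have "b * c 0 = (norm (c 0))\<^sup>2 * cis (Arg (c n))"
      by (simp add: cis_mult)
    moreover have "c n = norm (c n) * cis (Arg (c n))"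
      by (metis rcis_cmod_Arg rcis_def)
    ultimately show ?thesis
      by (simp add: algebra_simps)
  qed
  then have norm_eq: "norm (c n + 2 * b * c 0) = norm (c n) + 2 * (norm (c 0))\<^sup>2"
    by (simp only: norm_mult norm_cis norm_of_real) simp
  \<comment> \<open>The circles must stay inside the open disc, so the estimate for radius 1 is
    reached as the limit \<open>s\<close> to 1 from the left.\<close>
  have "norm (c n) + 2 * (norm (c 0))\<^sup>2 \<le> 1 + (norm (c 0))\<^sup>2"
  proof (rule tendsto_upperbound)
    show "((\<lambda>s. s ^ n * (norm (c n) + 2 * (norm (c 0))\<^sup>2)) \<longlongrightarrow> norm (c n) + 2 * (norm (c 0))\<^sup>2) (at_left (1::real))"
      by (auto intro!: tendsto_eq_intros)
    have "s ^ n * (norm (c n) + 2 * (norm (c 0))\<^sup>2) \<le> 1 + (norm (c 0))\<^sup>2" if "s \<in> {0<..<1}" for s :: real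
    proof -
      have "s ^ n * (norm (c n) + 2 * (norm (c 0))\<^sup>2) \<le> 1 + (norm (c 0))\<^sup>2 * (s ^ n)\<^sup>2"
        using *[of s b] that by (simp add: norm_eq) (simp add: b_def norm_mult)
      also have "\<dots> \<le> 1 + (norm (c 0))\<^sup>2"
        using that by (simp add: mult_left_le power_le_one)
      finally show ?thesis .
    qed
    then show "\<forall>\<^sub>F s in at_left (1::real). s ^ n * (norm (c n) + 2 * (norm (c 0))\<^sup>2) \<le> 1 + (norm (c 0))\<^sup>2"
      using eventually_at_left_real[of 0 "1::real"] by (auto elim: eventually_mono)
  qed simp
  then show ?thesis
    by simp
qed

section \<open>From scalar series to octonionic coefficients\<close>

lemma SRB_coeff_le:
  assumes f: "f \<in> SRB" and a: "power_series_expansion f a" and n: "n > 0"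
  shows "norm (a n) \<le> 1 - (norm (a 0))\<^sup>2"
proof -
  obtain u where u: "norm u = 1" "a 0 = norm (a 0) *\<^sub>R u"
  proof (cases "a 0 = 0")
    case True
    then show thesis
      by (intro that[of 1]) (auto simp: norm_oct_def inner_oct_def inner_quat_def)
  next
    case False
    then show thesis
      by (intro that[of "a 0 /\<^sub>R norm (a 0)"]) auto
  qed
  \<comment> \<open>The slice depends on \<open>n\<close>: since \<open>u\<close> is a unit vector,
    \<open>ocnj u\<close> is its inverse, and \<open>I\<close> is chosen so that the quotient of
    \<open>a n\<close> by \<open>u\<close> lies in its slice.\<close>
  obtain I w where I: "I \<in> imaginary_units" and w: "a n * ocnj u = slice_embed I w"
    by (rule oct_in_slice)
  \<comment> \<open>The cancellation holds despite non-associativity; it is checked on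
    components.\<close>
  have "(a n * ocnj u) * u = (inner u u) *\<^sub>R a n"
    by (simp add: oct_eq_iff quat_eq_iff inner_oct_def inner_quat_def algebra_simps)
  then have an: "a n = slice_embed I w * u"
    using u(1) by (simp add: w norm_eq_1)
  interpret bounded_linear "slice_coord I u"
    by (rule bounded_linear_slice_coord)
  have in_ball: "slice_embed I z \<in> ball 0 1" if "norm z < 1" for z
    using that by (simp add: norm_slice_embed[OF I])
  have "norm (slice_coord I u (a n)) \<le> 1 - (norm (slice_coord I u (a 0)))\<^sup>2"
  proof (rule bounded_power_series_coeff_le[where h = "\<lambda>z. slice_coord I u (f (slice_embed I z))"])
    fix z :: complex
    assume z: "norm z < 1"
    have "(\<lambda>k. slice_embed I z ^ k * a k) sums f (slice_embed I z)"
      using a in_ball[OF z] by (simp add: power_series_expansion_def)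
    then have "(\<lambda>k. slice_coord I u (slice_embed I (z ^ k) * a k)) sums slice_coord I u (f (slice_embed I z))"
      by (intro sums) (simp add: slice_embed_power[OF I])
    then show "(\<lambda>k. slice_coord I u (a k) * z ^ k) sums slice_coord I u (f (slice_embed I z))"
      by (simp add: slice_coord_slice_embed_mult[OF I] mult.commute)
    have "norm (f (slice_embed I z)) \<le> 1"
      using f in_ball[OF z] by (simp add: SRB_def)
    then show "norm (slice_coord I u (f (slice_embed I z))) \<le> 1"
      using norm_slice_coord_le[OF I u(1)] by (rule order_trans[rotated])
  qed (rule n)
  moreover have "slice_coord I u (a n) = w"
    by (simp add: an slice_coord_slice_embed_mult[OF I] slice_coord_self[OF I u(1)])
  moreover have "norm (a n) = norm w"
    by (simp add: an norm_oct_mult norm_slice_embed[OF I] u(1))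
  moreover have "slice_coord I u (a 0) = norm (a 0)"
    by (subst u(2)) (simp add: scaleR slice_coord_self[OF I u(1)] scaleR_conv_of_real)
  ultimately show ?thesis
    by simp
qed

lemma SRB_coeff_0_le:
  assumes f: "f \<in> SRB" and a: "power_series_expansion f a"
  shows "norm (a 0) \<le> 1"
proof -
  \<comment> \<open>Evaluation at the origin: since \<open>0 ^ 0 = 1\<close>, only the constant term
    survives.\<close>
  have "(\<lambda>k. 0 ^ k * a k) sums f 0"
    using a by (simp add: power_series_expansion_def)
  moreover have "(\<lambda>k. 0 ^ k * a k) sums (\<Sum>k\<in>{0}. 0 ^ k * a k)"
  proof (rule sums_finite)
    fix k :: nat
    assume "k \<notin> {0}"
    then show "0 ^ k * a k = 0"
      by (cases k) (simp_all add: oct_eq_iff quat_eq_iff)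
  qed simp
  ultimately have "f 0 = (\<Sum>k\<in>{0}. 0 ^ k * a k)"
    by (rule sums_unique2)
  also have "\<dots> = a 0"
    by (simp add: oct_eq_iff quat_eq_iff)
  finally have "f 0 = a 0" .
  moreover have "norm (f 0) \<le> 1"
    using f by (simp add: SRB_def)
  ultimately show ?thesis
    by simp
qed

section \<open>Slice regular functions with real coefficients\<close>

text \<open>Real coefficients keep every slice invariant, so on each slice \<open>f\<close> is a
  copy of the complex function \<open>g\<close>.\<close>

lemma slice_function_of_real_series:
  fixes b :: "nat \<Rightarrow> real" and g :: "complex \<Rightarrow> complex"
  assumes sums: "\<And>z. norm z < 1 \<Longrightarrow> (\<lambda>k. of_real (b k) * z ^ k) sums g z"
  defines "f \<equiv> (\<lambda>x. \<Sum>k. x ^ k * (b k *\<^sub>R (1::oct)))"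
  shows "power_series_expansion f (\<lambda>k. b k *\<^sub>R 1)"
    and "\<And>I z. I \<in> imaginary_units \<Longrightarrow> norm z < 1 \<Longrightarrow> f (slice_embed I z) = slice_embed I (g z)"
proof -
  have *: "(\<lambda>k. slice_embed I z ^ k * (b k *\<^sub>R 1)) sums slice_embed I (g z)"
    if I: "I \<in> imaginary_units" and z: "norm z < 1" for I z
  proof -
    have "slice_embed I z ^ k * (b k *\<^sub>R 1) = slice_embed I (of_real (b k) * z ^ k)" for k
      by (simp add: slice_embed_power[OF I] oct_eq_iff quat_eq_iff) (simp add: slice_embed_def algebra_simps)
    then show ?thesis
      using bounded_linear.sums[OF bounded_linear_slice_embed sums[OF z]] by simp
  qed
  then show "f (slice_embed I z) = slice_embed I (g z)" if "I \<in> imaginary_units" "norm z < 1" for I z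
    using that unfolding f_def by (metis sums_unique)
  show "power_series_expansion f (\<lambda>k. b k *\<^sub>R 1)"
    unfolding power_series_expansion_def
  proof
    fix x :: oct
    assume x: "x \<in> ball 0 1"
    obtain I z where Iz: "I \<in> imaginary_units" "x = slice_embed I z"
      by (rule oct_in_slice)
    with x have "norm z < 1"
      by (simp add: norm_slice_embed)
    from *[OF Iz(1) this] show "(\<lambda>k. x ^ k * (b k *\<^sub>R 1)) sums f x"
      unfolding f_def Iz(2) by (simp add: sums_iff)
  qed
qed

lemma has_vector_derivative_slices:
  assumes "(g has_field_derivative g') (at z)"
  shows "((\<lambda>t. g (Complex t (Im z))) has_vector_derivative g') (at (Re z))"
    and "((\<lambda>t. g (Complex (Re z) t)) has_vector_derivative \<i> * g') (at (Im z))"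
proof -
  have "((\<lambda>t. Complex t (Im z)) has_vector_derivative 1) (at (Re z))"
    unfolding Complex_eq by (auto intro!: derivative_eq_intros)
  from field_vector_diff_chain_at[OF this, of g g'] assms
  show "((\<lambda>t. g (Complex t (Im z))) has_vector_derivative g') (at (Re z))"
    by (simp add: o_def)
  have "((\<lambda>t. Complex (Re z) t) has_vector_derivative \<i>) (at (Im z))"
    unfolding Complex_eq by (auto intro!: derivative_eq_intros)
  from field_vector_diff_chain_at[OF this, of g g'] assms
  show "((\<lambda>t. g (Complex (Re z) t)) has_vector_derivative \<i> * g') (at (Im z))"
    by (simp add: o_def)
qed

text \<open>The stem function has components \<open>Re (g z)\<close> and \<open>Im (g z)\<close>,
  embedded as real octonions. Its parity is \<open>g (cnj z) = cnj (g z)\<close>, which holds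
  because the coefficients are real; the Cauchy-Riemann equations come from the factor
  \<open>\<i>\<close> in the vertical derivative; the bound transfers because slices are embedded
  isometrically.\<close>

lemma SRB_of_real_series:
  fixes b :: "nat \<Rightarrow> real" and g :: "complex \<Rightarrow> complex"
  assumes sums: "\<And>z. norm z < 1 \<Longrightarrow> (\<lambda>k. of_real (b k) * z ^ k) sums g z"
    and le: "\<And>z. norm z < 1 \<Longrightarrow> norm (g z) \<le> 1"
  shows "(\<lambda>x. \<Sum>k. x ^ k * (b k *\<^sub>R 1)) \<in> SRB"
proof -
  define f where "f = (\<lambda>x. \<Sum>k. x ^ k * (b k *\<^sub>R (1::oct)))"
  have f: "f (slice_embed I z) = slice_embed I (g z)" if "I \<in> imaginary_units" "norm z < 1" for I z
    unfolding f_def using slice_function_of_real_series(2)[OF sums] that by blast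
  have holo: "g holomorphic_on ball 0 1"
    by (rule power_series_holomorphic[where a = "\<lambda>k. of_real (b k)"]) (use sums in auto)
  have g_cnj: "g (cnj z) = cnj (g z)" if "norm z < 1" for z
  proof -
    have "(\<lambda>k. of_real (b k) * cnj z ^ k) sums cnj (g z)"
      using sums_cnj[THEN iffD2, OF sums[OF that]] by simp
    then show ?thesis
      using sums[of "cnj z"] that by (simp add: sums_unique2)
  qed
  have deriv: "(g has_field_derivative deriv g z) (at z)" if "z \<in> ball 0 1" for z
    using holomorphic_derivI[OF holo _ that] by simp
  have cont: "continuous_on (ball 0 1) (deriv g)"
    by (intro holomorphic_on_imp_continuous_on holomorphic_deriv holo) simp
  have lin: "((\<lambda>t. l (q t) *\<^sub>R (1::oct)) has_vector_derivative l D *\<^sub>R 1) (at t)"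
    if "(q has_vector_derivative D) (at t)" "bounded_linear l" for l :: "complex \<Rightarrow> real" and q D t
    using bounded_linear.has_vector_derivative[OF bounded_linear_compose[OF bounded_linear_scaleR_left that(2)] that(1)] .
  have stem: "stem_function (\<lambda>z. Re (g z) *\<^sub>R 1) (\<lambda>z. Im (g z) *\<^sub>R 1)"
    by (simp add: stem_function_def g_cnj)
  have slice: "induces_slice_function (\<lambda>z. Re (g z) *\<^sub>R 1) (\<lambda>z. Im (g z) *\<^sub>R 1) f"
    unfolding induces_slice_function_def
  proof (intro ballI allI impI)
    fix I \<alpha> \<beta>
    assume "I \<in> imaginary_units" "Complex \<alpha> \<beta> \<in> ball 0 1"
    then have "f (slice_embed I (Complex \<alpha> \<beta>)) = slice_embed I (g (Complex \<alpha> \<beta>))"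
      by (simp add: f)
    moreover have "I * (t *\<^sub>R 1) = t *\<^sub>R I" for t
      by (simp add: oct_eq_iff quat_eq_iff)
    ultimately show "f (\<alpha> *\<^sub>R 1 + \<beta> *\<^sub>R I) = Re (g (Complex \<alpha> \<beta>)) *\<^sub>R 1 + I * (Im (g (Complex \<alpha> \<beta>)) *\<^sub>R 1)"
      by (simp add: slice_embed_def)
  qed
  have partials: "has_partials_on_disc (\<lambda>z. Re (g z) *\<^sub>R 1) (\<lambda>z. Re (deriv g z) *\<^sub>R 1) (\<lambda>z. Re (\<i> * deriv g z) *\<^sub>R 1)"
    "has_partials_on_disc (\<lambda>z. Im (g z) *\<^sub>R 1) (\<lambda>z. Im (deriv g z) *\<^sub>R 1) (\<lambda>z. Im (\<i> * deriv g z) *\<^sub>R 1)"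
    unfolding has_partials_on_disc_def
    by (intro ballI conjI lin has_vector_derivative_slices deriv bounded_linear_Re bounded_linear_Im; assumption)+
  have conts: "continuous_on (ball 0 1) (\<lambda>z. Re (deriv g z) *\<^sub>R (1::oct))"
    "continuous_on (ball 0 1) (\<lambda>z. Re (\<i> * deriv g z) *\<^sub>R (1::oct))"
    "continuous_on (ball 0 1) (\<lambda>z. Im (deriv g z) *\<^sub>R (1::oct))"
    "continuous_on (ball 0 1) (\<lambda>z. Im (\<i> * deriv g z) *\<^sub>R (1::oct))"
    by (intro continuous_intros cont)+
  have cr: "\<forall>z\<in>ball 0 1. Re (deriv g z) *\<^sub>R (1::oct) = Im (\<i> * deriv g z) *\<^sub>R 1 \<and>
      Re (\<i> * deriv g z) *\<^sub>R (1::oct) = - (Im (deriv g z) *\<^sub>R 1)"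
    by simp
  have "slice_regular f"
    unfolding slice_regular_def by (intro exI conjI) (rule stem slice partials conts cr)+
  moreover have "norm (f x) \<le> 1" if x: "x \<in> ball 0 1" for x
  proof -
    obtain I z where Iz: "I \<in> imaginary_units" "x = slice_embed I z"
      by (rule oct_in_slice)
    with x have "norm z < 1"
      by (simp add: norm_slice_embed)
    then show ?thesis
      by (simp add: Iz f norm_slice_embed le)
  qed
  ultimately show ?thesis
    by (simp add: SRB_def f_def)
qed
section \<open>The critical radius\<close>

lemma cesaro_kernel_sums:
  fixes r :: real
  assumes "0 < r" "r < 1"
  shows "(\<lambda>k. r ^ k / real (k + 1)) sums (1 / r * ln (1 / (1 - r)))"
proof -
  have "(\<lambda>n. - (r ^ n) / real n) sums ln (1 - r)"
    using ln_series'[of "- r"] assms by simp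
  \<comment> \<open>The term at index 0 is a division by zero, hence 0, so the shift leaves the sum
    unchanged.\<close>
  then have "(\<lambda>n. - (r ^ Suc n) / real (Suc n)) sums ln (1 - r)"
    by (subst sums_Suc_iff) simp
  then have "(\<lambda>n. - 1 / r * (- (r ^ Suc n) / real (Suc n))) sums (- 1 / r * ln (1 - r))"
    by (rule sums_mult)
  then show ?thesis
    using assms by (simp add: ln_div field_simps)
qed

text \<open>The derivative \<open>(t - ln (1 / (1 - t))) / t\<^sup>2\<close> is negative because
  \<open>ln s < s - 1\<close> for positive \<open>s \<noteq> 1\<close>. Dividing the equation for
  \<open>R\<close> by \<open>3 * y\<close> makes this quotient equal to \<open>2 / 3\<close>, so
  monotonicity gives uniqueness of the root.\<close>

lemma strict_antimono_log_quotient: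
  fixes x y :: real
  assumes "0 < x" "x < y" "y < 1"
  shows "(1 - y) / y * ln (1 / (1 - y)) < (1 - x) / x * ln (1 / (1 - x))"
proof (rule DERIV_neg_imp_decreasing[OF \<open>x < y\<close>])
  fix t :: real
  assume t: "x \<le> t" "t \<le> y"
  have "ln (1 / (1 - t)) > t"
  proof -
    have "ln (1 - t) \<noteq> (1 - t) - 1"
      using ln_eq_minus_one[of "1 - t"] t assms by auto
    then show ?thesis
      using ln_le_minus_one[of "1 - t"] t assms by (simp add: ln_div)
  qed
  moreover have "((\<lambda>t. (1 - t) / t * ln (1 / (1 - t))) has_real_derivative (t - ln (1 / (1 - t))) / t\<^sup>2) (at t)"
  proof -
    have "((\<lambda>t. ln (1 / (1 - t))) has_real_derivative 1 / (1 - t)) (at t)"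
      using t assms by (auto intro!: derivative_eq_intros simp: divide_simps)
    moreover have "((\<lambda>t. (1 - t) / t) has_real_derivative - 1 / t\<^sup>2) (at t)"
      using t assms by (auto intro!: derivative_eq_intros simp: field_simps power2_eq_square)
    ultimately have "((\<lambda>t. (1 - t) / t * ln (1 / (1 - t))) has_real_derivative
        - 1 / t\<^sup>2 * ln (1 / (1 - t)) + 1 / (1 - t) * ((1 - t) / t)) (at t)"
      using DERIV_mult by blast
    then show ?thesis
      by (rule DERIV_cong) (use t assms in \<open>simp add: field_simps power2_eq_square\<close>)
  qed
  ultimately show "\<exists>z. ((\<lambda>t. (1 - t) / t * ln (1 / (1 - t))) has_real_derivative z) (at t) \<and> z < 0"
    using t assms by (intro exI conjI) (auto simp: divide_neg_pos)
qed

lemma ln_bounds: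
  shows "3 * (1 - 0.5335) * ln (1 / (1 - 0.5335)) > 2 * (0.5335 :: real)"
    and "3 * (1 - 0.5336) * ln (1 / (1 - 0.5336)) < 2 * (0.5336 :: real)"
proof -
  \<comment> \<open>Here \<open>10000 / 4665\<close> is \<open>1 / (1 - 0.5335)\<close>, and the
    logarithm has to exceed \<open>1.067 / 1.3995\<close>, just below 0.76242. For 0.5336 it has to
    stay under \<open>1.0672 / 1.3992\<close>, just above 0.76272.\<close>
  have "ln (10000 / 4665 :: real) > 0.76246"
    using ln_approx_bounds[of "10000 / 4665" 6] by (simp add: eval_nat_numeral)
  then show "3 * (1 - 0.5335) * ln (1 / (1 - 0.5335)) > 2 * (0.5335 :: real)"
    by simp
  have "ln (10000 / 4664 :: real) < 0.76272"
    using ln_approx_bounds[of "10000 / 4664" 6] by (simp add: eval_nat_numeral)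
  then show "3 * (1 - 0.5336) * ln (1 / (1 - 0.5336)) < 2 * (0.5336 :: real)"
    by simp
qed

lemma critical_radius:
  obtains R :: real where "0.5335 < R" "R < 0.5336"
    "\<And>y. 0 < y \<and> y < 1 \<and> 2 * y - 3 * (1 - y) * ln (1 / (1 - y)) = 0 \<longleftrightarrow> y = R"
    "\<And>r. 0 < r \<Longrightarrow> r \<le> R \<Longrightarrow> 2 * r \<le> 3 * (1 - r) * ln (1 / (1 - r))"
    "\<And>r. R < r \<Longrightarrow> r < 1 \<Longrightarrow> 3 * (1 - r) * ln (1 / (1 - r)) < 2 * r"
proof -
  define \<psi> :: "real \<Rightarrow> real" where "\<psi> y = (1 - y) / y * ln (1 / (1 - y))" for y
  have anti: "\<psi> y < \<psi> x" if "0 < x" "x < y" "y < 1" for x y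
    using strict_antimono_log_quotient[OF that] by (simp add: \<psi>_def)
  have mult_\<psi>: "3 * (1 - y) * ln (1 / (1 - y)) = 3 * y * \<psi> y" if "0 < y" for y
    using that by (simp add: \<psi>_def field_simps)
  have "\<psi> 0.5335 > 2 / 3" "\<psi> 0.5336 < 2 / 3"
    using ln_bounds by (simp_all add: \<psi>_def field_simps)
  moreover have "continuous_on {0.5335..0.5336} \<psi>"
    unfolding \<psi>_def by (intro continuous_intros) auto
  ultimately obtain R where R: "0.5335 \<le> R" "R \<le> 0.5336" "\<psi> R = 2 / 3"
    using IVT2'[of \<psi> "0.5336" "2 / 3" "0.5335"] by auto
  show thesis
  proof
    \<comment> \<open>The intermediate value theorem gives a closed interval; the strict values of
      \<open>\<psi>\<close> at its ends exclude them.\<close>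
    have "R \<noteq> 0.5335" "R \<noteq> 0.5336"
      using R(3) \<open>\<psi> 0.5335 > 2 / 3\<close> \<open>\<psi> 0.5336 < 2 / 3\<close> by (metis less_irrefl)+
    then show "0.5335 < R" "R < 0.5336"
      using R(1,2) by linarith+
    show "0 < y \<and> y < 1 \<and> 2 * y - 3 * (1 - y) * ln (1 / (1 - y)) = 0 \<longleftrightarrow> y = R" for y
    proof
      assume y: "0 < y \<and> y < 1 \<and> 2 * y - 3 * (1 - y) * ln (1 / (1 - y)) = 0"
      then have "\<psi> y = 2 / 3"
        using mult_\<psi>[of y] by auto
      then show "y = R"
        using anti[of y R] anti[of R y] R y by (cases y R rule: linorder_cases) auto
    qed (use R mult_\<psi>[of R] in auto)
    show "2 * r \<le> 3 * (1 - r) * ln (1 / (1 - r))" if "0 < r" "r \<le> R" for r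
    proof -
      have "2 / 3 \<le> \<psi> r"
        using anti[of r R] R that by (cases "r = R") auto
      then show ?thesis
        using that mult_\<psi>[of r] by auto
    qed
    show "3 * (1 - r) * ln (1 / (1 - r)) < 2 * r" if "R < r" "r < 1" for r
    proof -
      have "\<psi> r < 2 / 3"
        using anti[of R r] R that by auto
      then show ?thesis
        using that R mult_\<psi>[of r] by auto
    qed
  qed
qed

section \<open>The inequality and its sharpness\<close>

text \<open>Writing \<open>k / (k + 1) = 1 - 1 / (k + 1)\<close> splits the series into a geometric
  one and the logarithmic kernel. It majorizes the Cesaro sum once every \<open>norm (a n)\<close>
  with \<open>n > 0\<close> is bounded by \<open>1 - A\<^sup>2\<close>.\<close>

lemma cesaro_majorant_bound_sums:
  fixes A r :: real
  assumes "0 < r" "r < 1"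
  shows "(\<lambda>k. r ^ k / real (k + 1) * (A + real k * (1 - A\<^sup>2))) sums
    (A * (1 / r * ln (1 / (1 - r))) + (1 - A\<^sup>2) * (1 / (1 - r) - 1 / r * ln (1 / (1 - r))))"
proof -
  have "(\<lambda>k. A * (r ^ k / real (k + 1)) + (1 - A\<^sup>2) * (r ^ k - r ^ k / real (k + 1))) sums
    (A * (1 / r * ln (1 / (1 - r))) + (1 - A\<^sup>2) * (1 / (1 - r) - 1 / r * ln (1 / (1 - r))))"
    using assms by (intro sums_add sums_mult sums_diff cesaro_kernel_sums geometric_sums) auto
  moreover have "A * (r ^ k / real (k + 1)) + (1 - A\<^sup>2) * (r ^ k - r ^ k / real (k + 1)) =
      r ^ k / real (k + 1) * (A + real k * (1 - A\<^sup>2))" for k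
    by (simp add: divide_simps) (simp add: algebra_simps)
  ultimately show ?thesis
    by simp
qed

lemma cesaro_majorant_le:
  assumes f: "f \<in> SRB" "power_series_expansion f a"
    and r: "0 < r" "r < 1" and crit: "2 * r \<le> 3 * (1 - r) * ln (1 / (1 - r))"
  shows "summable (cesaro_majorant_term a r)"
    and "(\<Sum>k. cesaro_majorant_term a r k) \<le> 1 / r * ln (1 / (1 - r))"
proof -
  define A where "A = norm (a 0)"
  define L where "L = 1 / r * ln (1 / (1 - r))"
  have A: "0 \<le> A" "A \<le> 1"
    using SRB_coeff_0_le[OF f] by (auto simp: A_def)
  have partial: "(\<Sum>n=0..k. norm (a n)) \<le> A + real k * (1 - A\<^sup>2)" for k
  proof (induction k)
    case (Suc k)
    then show ?case
      using SRB_coeff_le[OF f, of "Suc k"] by (simp add: A_def algebra_simps)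
  qed (simp add: A_def)
  define M where "M = (\<lambda>k. r ^ k / real (k + 1) * (A + real k * (1 - A\<^sup>2)))"
  have M: "M sums (A * L + (1 - A\<^sup>2) * (1 / (1 - r) - L))"
    unfolding M_def L_def by (rule cesaro_majorant_bound_sums[OF r])
  have le_M: "cesaro_majorant_term a r k \<le> M k" for k
  proof -
    have "r ^ k / real (k + 1) * (\<Sum>n=0..k. norm (a n)) \<le> M k"
      unfolding M_def using r by (intro mult_left_mono partial) auto
    then show ?thesis
      by (simp add: cesaro_majorant_term_def)
  qed
  have nonneg: "0 \<le> cesaro_majorant_term a r k" for k
    using r by (auto simp: cesaro_majorant_term_def intro!: divide_nonneg_nonneg mult_nonneg_nonneg sum_nonneg)
  show sm: "summable (cesaro_majorant_term a r)"
    by (rule summable_comparison_test'[OF sums_summable[OF M], of 0]) (use le_M nonneg in auto)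
  have "(\<Sum>k. cesaro_majorant_term a r k) \<le> A * L + (1 - A\<^sup>2) * (1 / (1 - r) - L)"
    using suminf_le[OF le_M sm sums_summable[OF M]] sums_unique[OF M] by simp
  also have "\<dots> \<le> L"
  proof -
    have "2 / (1 - r) \<le> 3 * L"
      using crit r by (simp add: L_def field_simps)
    then have "2 * (1 / (1 - r) - L) \<le> L"
      by simp
    moreover have "0 \<le> L"
      using r by (auto simp: L_def intro!: mult_nonneg_nonneg)
    \<comment> \<open>This is the goal with \<open>1 - A\<close> factored out. A positive bracket is
      worst at \<open>A = 1\<close>, where the critical inequality applies; otherwise the left side
      is nonpositive.\<close>
    ultimately have "(1 + A) * (1 / (1 - r) - L) \<le> L"
    proof (cases "1 / (1 - r) - L \<le> 0")
      case True
      then show ?thesis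
        using A \<open>0 \<le> L\<close> mult_nonneg_nonpos[of "1 + A" "1 / (1 - r) - L"] by linarith
    next
      case False
      then have "(1 + A) * (1 / (1 - r) - L) \<le> 2 * (1 / (1 - r) - L)"
        using A by (intro mult_right_mono) auto
      with \<open>2 * (1 / (1 - r) - L) \<le> L\<close> show ?thesis
        by linarith
    qed
    then have "(1 - A) * ((1 + A) * (1 / (1 - r) - L)) \<le> (1 - A) * L"
      using A by (intro mult_left_mono) auto
    then show ?thesis
      by (simp add: power2_eq_square algebra_simps)
  qed
  finally show "(\<Sum>k. cesaro_majorant_term a r k) \<le> 1 / r * ln (1 / (1 - r))"
    by (simp add: L_def)
qed

section \<open>Sharpness: Moebius functions as counterexamples\<close>

definition moebius_coeff :: "real \<Rightarrow> nat \<Rightarrow> real" where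
  "moebius_coeff c k = (if k = 0 then c else - (1 - c\<^sup>2) * c ^ (k - 1))"

text \<open>The geometric series applied to \<open>(c - z) / (1 - c * z) = c - (1 - c\<^sup>2) * z /
  (1 - c * z)\<close>.\<close>

lemma moebius_coeff_sums:
  fixes z :: complex
  assumes c: "0 < c" "c < 1" and z: "norm z < 1"
  shows "(\<lambda>k. of_real (moebius_coeff c k) * z ^ k) sums ((of_real c - z) / (1 - of_real c * z))"
proof -
  have cz: "norm (of_real c * z) < 1"
    using mult_strict_mono'[of c 1 "norm z" 1] c z by (simp add: norm_mult)
  then have nz: "1 - of_real c * z \<noteq> 0"
    by auto
  have "(\<lambda>k. - (1 - (of_real c)\<^sup>2) * z * (of_real c * z) ^ k) sums (- (1 - (of_real c)\<^sup>2) * z * (1 / (1 - of_real c * z)))"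
    by (intro sums_mult geometric_sums cz)
  then have "(\<lambda>k. of_real (moebius_coeff c (Suc k)) * z ^ Suc k) sums (- (1 - (of_real c)\<^sup>2) * z * (1 / (1 - of_real c * z)))"
    by (simp add: moebius_coeff_def power_mult_distrib mult_ac)
  then have "(\<lambda>k. of_real (moebius_coeff c k) * z ^ k) sums
      (- (1 - (of_real c)\<^sup>2) * z * (1 / (1 - of_real c * z)) + of_real (moebius_coeff c 0) * z ^ 0)"
    by (subst (asm) sums_Suc_iff) simp
  also have "- (1 - (of_real c)\<^sup>2) * z * (1 / (1 - of_real c * z)) + of_real (moebius_coeff c 0) * z ^ 0 =
      (of_real c - z) / (1 - of_real c * z)"
    using nz by (simp add: moebius_coeff_def divide_simps) (simp add: algebra_simps power2_eq_square)
  finally show ?thesis .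
qed

lemma norm_moebius_le:
  fixes z :: complex
  assumes c: "0 < c" "c < 1" and z: "norm z < 1"
  shows "norm ((of_real c - z) / (1 - of_real c * z)) \<le> 1"
proof -
  have "(norm (1 - of_real c * z))\<^sup>2 - (norm (of_real c - z))\<^sup>2 = (1 - c\<^sup>2) * (1 - (norm z)\<^sup>2)"
    by (simp add: cmod_power2) (simp add: power2_eq_square algebra_simps)
  also have "\<dots> \<ge> 0"
    using c z by (intro mult_nonneg_nonneg) (auto simp: abs_square_le_1)
  finally have "(norm (of_real c - z))\<^sup>2 \<le> (norm (1 - of_real c * z))\<^sup>2"
    by linarith
  then have "norm (of_real c - z) \<le> norm (1 - of_real c * z)"
    by (rule power2_le_imp_le) (rule norm_ge_zero)
  then show ?thesis
    using norm_ge_zero[of "1 - of_real c * z"] by (simp only: norm_divide divide_le_eq_1) argo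
qed

text \<open>The first summand adds up to exactly the bound of the inequality. The excess is isolated
  with its factor \<open>1 - c\<close>, so only its sign matters, however close \<open>c\<close> is
  to 1.\<close>

lemma cesaro_majorant_moebius:
  fixes c r :: real
  assumes c: "0 < c" "c < 1"
  shows "cesaro_majorant_term (\<lambda>k. moebius_coeff c k *\<^sub>R 1) r k =
    r ^ k / real (k + 1) + (1 - c) * (r ^ k / real (k + 1) * ((1 + c) * (\<Sum>j<k. c ^ j) - 1))"
proof -
  have "norm (1::oct) = 1"
    by (simp add: norm_oct_def inner_oct_def inner_quat_def)
  moreover have "(\<Sum>n=0..k. \<bar>moebius_coeff c n\<bar>) = 1 + (1 - c) * ((1 + c) * (\<Sum>j<k. c ^ j) - 1)"
  proof (induction k)
    case 0
    show ?case
      using c by (simp add: moebius_coeff_def)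
  next
    case (Suc k)
    have "1 - c\<^sup>2 \<ge> 0"
      using c by (simp add: abs_square_le_1)
    then have "\<bar>moebius_coeff c (Suc k)\<bar> = (1 - c) * (1 + c) * c ^ k"
      using c by (simp add: moebius_coeff_def abs_mult) (simp add: power2_eq_square algebra_simps)
    then show ?case
      using Suc by (simp add: algebra_simps)
  qed
  ultimately have "cesaro_majorant_term (\<lambda>k. moebius_coeff c k *\<^sub>R 1) r k =
      r ^ k / real (k + 1) * (1 + (1 - c) * ((1 + c) * (\<Sum>j<k. c ^ j) - 1))"
    by (simp add: cesaro_majorant_term_def)
  then show ?thesis
    by (simp only: distrib_left mult_1_right mult.left_commute)
qed

lemma exists_cesaro_majorant_gt:
  fixes r :: real
  assumes r: "0 < r" "r < 1" and crit: "3 * (1 - r) * ln (1 / (1 - r)) < 2 * r"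
  obtains f a where "f \<in> SRB" "power_series_expansion f a"
    "summable (cesaro_majorant_term a r)"
    "(\<Sum>k. cesaro_majorant_term a r k) > 1 / r * ln (1 / (1 - r))"
proof -
  define L where "L = 1 / r * ln (1 / (1 - r))"
  define p where "p = (\<lambda>k. r ^ k / real (k + 1))"
  have p: "p sums L" and p_nonneg: "0 \<le> p k" for k
    using cesaro_kernel_sums[OF r] r by (simp_all add: p_def L_def)
  \<comment> \<open>Truncation avoids exchanging the limit \<open>c\<close> to 1 with an infinite
    sum: a finite \<open>S c N\<close> is continuous in \<open>c\<close>, and nonnegative terms make
    it a lower bound for the full series.\<close>
  define S where "S = (\<lambda>c N. \<Sum>k<N. p k * ((1 + c) * (\<Sum>j<k. c ^ j)))"
  have "(\<lambda>N. S 1 N) \<longlonglongrightarrow> 2 * (1 / (1 - r) - L)"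
  proof -
    have "(\<lambda>k. 2 * (r ^ k - p k)) sums (2 * (1 / (1 - r) - L))"
      using r by (intro sums_mult sums_diff geometric_sums p) auto
    moreover have "2 * (r ^ k - p k) = p k * ((1 + 1) * (\<Sum>j<k. 1 ^ j))" for k
      by (simp add: p_def field_simps)
    ultimately show ?thesis
      by (simp add: sums_def S_def)
  qed
  \<comment> \<open>The reversed critical inequality says that the excess is already positive to
    first order at \<open>c = 1\<close>.\<close>
  moreover have "L < 2 * (1 / (1 - r) - L)"
  proof -
    have "r * (3 * (1 - r) * L) < r * 2"
      using crit r by (simp add: L_def mult_ac)
    then have "3 * L < 2 / (1 - r)"
      using r by (simp add: pos_less_divide_eq mult_ac)
    then show ?thesis
      by simp
  qed
  ultimately have "eventually (\<lambda>N. L < S 1 N) sequentially"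
    by (rule order_tendstoD)
  then obtain N where "L < S 1 N"
    by (auto simp: eventually_sequentially)
  moreover have "((\<lambda>c. S c N) \<longlongrightarrow> S 1 N) (at_left 1)"
    unfolding S_def by (intro tendsto_intros)
  ultimately have "eventually (\<lambda>c. L < S c N) (at_left 1)"
    using order_tendstoD(1) by blast
  then have "eventually (\<lambda>c. L < S c N \<and> c \<in> {0<..<1}) (at_left 1)"
    using eventually_at_left_real[of 0 "1::real"] by (auto intro: eventually_conj)
  then obtain c where c: "L < S c N" "0 < c" "c < 1"
    by (auto dest!: eventually_happens' [OF trivial_limit_at_left_real])
  define a where "a = (\<lambda>k. moebius_coeff c k *\<^sub>R (1::oct))"
  define T where "T = (\<lambda>k. p k * ((1 + c) * (\<Sum>j<k. c ^ j)))"
  have T_nonneg: "0 \<le> T k" for k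
    using c p_nonneg by (auto simp: T_def intro!: mult_nonneg_nonneg sum_nonneg)
  have T_summable: "summable T"
  proof (rule summable_comparison_test'[of "\<lambda>k. 2 * r ^ k" 0])
    show "summable (\<lambda>k. 2 * r ^ k)"
      using r by (intro summable_mult summable_geometric) auto
    fix k :: nat
    have "(\<Sum>j<k. c ^ j) \<le> (\<Sum>j<k. 1)"
      using c by (intro sum_mono power_le_one) auto
    then have "(1 + c) * (\<Sum>j<k. c ^ j) \<le> 2 * real (k + 1)"
      using c by (intro mult_mono sum_nonneg) auto
    then have "T k \<le> p k * (2 * real (k + 1))"
      unfolding T_def using p_nonneg by (rule mult_left_mono)
    also have "\<dots> = 2 * r ^ k"
      by (simp add: p_def divide_simps)
    finally show "norm (T k) \<le> 2 * r ^ k"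
      using T_nonneg[of k] by simp
  qed
  have "cesaro_majorant_term a r = (\<lambda>k. p k + (1 - c) * (T k - p k))"
    unfolding a_def cesaro_majorant_moebius[OF c(2,3)] fun_eq_iff
    by (simp add: p_def T_def algebra_simps)
  moreover have "(\<lambda>k. p k + (1 - c) * (T k - p k)) sums (L + (1 - c) * (suminf T - L))"
    by (intro sums_add sums_mult sums_diff p summable_sums T_summable)
  ultimately have sums: "cesaro_majorant_term a r sums (L + (1 - c) * (suminf T - L))"
    by simp
  have "S c N = sum T {..<N}"
    by (simp add: S_def T_def)
  also have "\<dots> \<le> suminf T"
    using T_nonneg by (intro sum_le_suminf T_summable) auto
  finally have "S c N \<le> suminf T" .
  then have "0 < (1 - c) * (suminf T - L)"
    using c by (intro mult_pos_pos) auto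
  with sums have "summable (cesaro_majorant_term a r)" "(\<Sum>k. cesaro_majorant_term a r k) > L"
    by (auto simp: sums_iff)
  moreover have "power_series_expansion (\<lambda>x. \<Sum>k. x ^ k * (moebius_coeff c k *\<^sub>R 1)) a"
    unfolding a_def by (rule slice_function_of_real_series(1)[OF moebius_coeff_sums[OF c(2,3)]])
  moreover have "(\<lambda>x. \<Sum>k. x ^ k * (moebius_coeff c k *\<^sub>R 1)) \<in> SRB"
    by (rule SRB_of_real_series[OF moebius_coeff_sums[OF c(2,3)] norm_moebius_le[OF c(2,3)]])
  ultimately show thesis
    using that by (simp add: L_def)
qed

theorem corollary2p1:
  shows "\<exists>R::real.
    (\<forall>y::real. 0 < y \<and> y < 1 \<and> 2 * y - 3 * (1 - y) * ln (1 / (1 - y)) = 0 \<longleftrightarrow> y = R) \<and>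
    0.5335 < R \<and> R < 0.5336 \<and>
    (\<forall>f a (x::oct). f \<in> SRB \<and> power_series_expansion f a \<and>
        x \<in> ball 0 1 \<and> 0 < norm x \<and> norm x \<le> R \<longrightarrow>
        summable (cesaro_majorant_term a (norm x)) \<and>
        (\<Sum>k. cesaro_majorant_term a (norm x) k) \<le> 1 / norm x * ln (1 / (1 - norm x))) \<and>
    (\<forall>r. R < r \<and> r < 1 \<longrightarrow>
        (\<exists>f a. f \<in> SRB \<and> power_series_expansion f a \<and>
          (\<forall>x::oct. norm x = r \<longrightarrow>
             summable (cesaro_majorant_term a (norm x)) \<and>
             (\<Sum>k. cesaro_majorant_term a (norm x) k) > 1 / norm x * ln (1 / (1 - norm x)))))"
proof -
  obtain R :: real where R: "0.5335 < R" "R < 0.5336"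
    and root: "\<And>y. 0 < y \<and> y < 1 \<and> 2 * y - 3 * (1 - y) * ln (1 / (1 - y)) = 0 \<longleftrightarrow> y = R"
    and below: "\<And>r. 0 < r \<Longrightarrow> r \<le> R \<Longrightarrow> 2 * r \<le> 3 * (1 - r) * ln (1 / (1 - r))"
    and above: "\<And>r. R < r \<Longrightarrow> r < 1 \<Longrightarrow> 3 * (1 - r) * ln (1 / (1 - r)) < 2 * r"
    by (rule critical_radius) blast
  show ?thesis
  proof (intro exI[of _ R] conjI[OF allI] conjI[OF R(1)] conjI[OF R(2)] conjI allI impI root)
    fix f a and x :: oct
    assume *: "f \<in> SRB \<and> power_series_expansion f a \<and> x \<in> ball 0 1 \<and> 0 < norm x \<and> norm x \<le> R"
    then have "norm x < 1"
      by simp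
    with * show "summable (cesaro_majorant_term a (norm x))"
      "(\<Sum>k. cesaro_majorant_term a (norm x) k) \<le> 1 / norm x * ln (1 / (1 - norm x))"
      by (meson cesaro_majorant_le below)+
  next
    fix r
    assume r: "R < r \<and> r < 1"
    then have "0 < r"
      using R by linarith
    \<comment> \<open>The majorant depends on \<open>x\<close> only through its norm, so one
      function serves the whole sphere of radius \<open>r\<close>.\<close>
    with r obtain f a where "f \<in> SRB" "power_series_expansion f a"
      "summable (cesaro_majorant_term a r)"
      "(\<Sum>k. cesaro_majorant_term a r k) > 1 / r * ln (1 / (1 - r))"
      using exists_cesaro_majorant_gt above by metis
    then show "\<exists>f a. f \<in> SRB \<and> power_series_expansion f a \<and>
        (\<forall>x::oct. norm x = r \<longrightarrow> summable (cesaro_majorant_term a (norm x)) \<and>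
          (\<Sum>k. cesaro_majorant_term a (norm x) k) > 1 / norm x * ln (1 / (1 - norm x)))"
      by blast
  qed
qed

end
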